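(* Let $\beta\in(0,1)$, $A<0$, and let $h:\mathbb{R}\to\mathbb{R}$ be measurable. For $x_0\in\mathbb{R}$ consider the equation $$X(t)=x_0+\frac{1}{\Gamma(\beta)}\int_0^t (t-s)^{\beta-1}\,[A X(s)+h(X(s))]\,ds,\qquad t\ge 0. \qquad ( * )$$ (a) Suppose there are $\delta_0>0$ and $C>0$ such that $A+C<0$ and $|h(x)|\le C|x|$ for all $|x|<\delta_0$. Then any continuous solution of $( * )$ is Mittag-Leffler stable, and therefore is also asymptotically stable. (b) Suppose there is $C>0$ such that $A+C<0$ and $|h(x)|\le C|x|$ for all $x\in\mathbb{R}$. Then any continuous solution of $( * )$ is Mittag-Leffler stable, and therefore is also globally stable in the large.
   Context: $\Gamma$ is the Gamma function, and for $a,b>0$, $z\in\mathbb{R}$, $E_{a,b}(z)=\sum_{k=0}^\infty \frac{z^k}{\Gamma(ka+b)}$ is the Mittag-Leffler function. A "continuous solution" is a continuous $X:[0,\infty)\to\mathbb{R}$ satisfying $( * )$ for all $t\ge0$. Any continuous solution of $( * )$ is said to be: - Mittag-Leffler stable if there are $\delta>0$, $B<0$, $b>0$ and a locally Lipschitz non-negative function $m:\mathbb{R}\to[0,\infty)$ with $m(0)=0$ such that, whenever $|x_0|<\delta$, every continuous solution $X$ of $( * )$ with initial value $x_0$ satisfies $|X(t)|\le [m(x_0)E_{\beta,1}(Bt^\beta)]^b$ for all $t\ge0$; - stable if for every $\varepsilon>0$ there is $\delta>0$ such that, whenever $|x_0|<\delta$, every continuous solution $X$ of $( * )$ with initial value $x_0$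 satisfies $|X(t)|<\varepsilon$ for all $t\ge0$; - stable in the large if there is $\delta>0$ such that, whenever $|x_0|<\delta$, every continuous solution $X$ of $( * )$ with initial value $x_0$ satisfies $\lim_{t\to\infty}X(t)=0$; - asymptotically stable if it is stable and stable in the large; - globally stable in the large if for every $x_0\in\mathbb{R}$ every continuous solution $X$ of $( * )$ with initial value $x_0$ satisfies $\lim_{t\to\infty}X(t)=0$. *)

theory Defs
  imports "HOL-Analysis.Analysis"
begin

definition mittag_leffler :: "real \<Rightarrow> real \<Rightarrow> real \<Rightarrow> real" where
  "mittag_leffler a b z = (\<Sum>k. z ^ k / Gamma (real k * a + b))"

text \<open>
  Only the restriction of \<^term>\<open>X :: real \<Rightarrow> real\<close> to the half-line \<^term>\<open>{0::real..}\<close> matters.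
  Since the Bochner integral of a non-integrable function is 0 by convention, integrability of
  the integrand is demanded explicitly: a solution is a function for which the right-hand side
  of the equation exists for all \<open>t \<ge> 0\<close>.
  At \<open>s = t\<close> the kernel takes the value \<open>0 powr (\<beta> - 1) = 0\<close>, which affects only a null set.
\<close>

definition continuous_solution ::
    "real \<Rightarrow> real \<Rightarrow> (real \<Rightarrow> real) \<Rightarrow> real \<Rightarrow> (real \<Rightarrow> real) \<Rightarrow> bool" where
  "continuous_solution \<beta> A h x0 X \<longleftrightarrow>
     continuous_on {0..} X \<and>
     (\<forall>t\<ge>0.
        set_integrable lborel {0..t} (\<lambda>s. (t - s) powr (\<beta> - 1) * (A * X s + h (X s))) \<and>
        X t = x0 + 1 / Gamma \<beta> *
          (LINT s:{0..t}|lborel. (t - s) powr (\<beta> - 1) * (A * X s + h (X s))))"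

text \<open>
  The stability notions below quantify over all continuous solutions, so they are properties
  of the equation, that is, of its data \<open>\<beta>\<close>, \<open>A\<close>, \<open>h\<close>.
  In \<^const>\<open>local_lipschitz\<close> the first set is the range of a time parameter, on which the
  function \<open>m\<close> here does not depend.
\<close>

definition mittag_leffler_stable :: "real \<Rightarrow> real \<Rightarrow> (real \<Rightarrow> real) \<Rightarrow> bool" where
  "mittag_leffler_stable \<beta> A h \<longleftrightarrow>
     (\<exists>\<delta> B b m. \<delta> > 0 \<and> B < 0 \<and> b > 0 \<and>
        local_lipschitz (UNIV :: real set) (UNIV :: real set) (\<lambda>_. m) \<and>
        (\<forall>x. m x \<ge> 0) \<and> m 0 = 0 \<and>
        (\<forall>x0 X. \<bar>x0\<bar> < \<delta> \<longrightarrow> continuous_solution \<beta> A h x0 X \<longrightarrow>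
           (\<forall>t\<ge>0. \<bar>X t\<bar> \<le> (m x0 * mittag_leffler \<beta> 1 (B * t powr \<beta>)) powr b)))"

definition stable :: "real \<Rightarrow> real \<Rightarrow> (real \<Rightarrow> real) \<Rightarrow> bool" where
  "stable \<beta> A h \<longleftrightarrow>
     (\<forall>\<epsilon>>0. \<exists>\<delta>>0. \<forall>x0 X. \<bar>x0\<bar> < \<delta> \<longrightarrow> continuous_solution \<beta> A h x0 X \<longrightarrow>
        (\<forall>t\<ge>0. \<bar>X t\<bar> < \<epsilon>))"

definition stable_in_the_large :: "real \<Rightarrow> real \<Rightarrow> (real \<Rightarrow> real) \<Rightarrow> bool" where
  "stable_in_the_large \<beta> A h \<longleftrightarrow>
     (\<exists>\<delta>>0. \<forall>x0 X. \<bar>x0\<bar> < \<delta> \<longrightarrow> continuous_solution \<beta> A h x0 X \<longrightarrow>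
        (X \<longlongrightarrow> 0) at_top)"

definition asymptotically_stable :: "real \<Rightarrow> real \<Rightarrow> (real \<Rightarrow> real) \<Rightarrow> bool" where
  "asymptotically_stable \<beta> A h \<longleftrightarrow> stable \<beta> A h \<and> stable_in_the_large \<beta> A h"

definition globally_stable_in_the_large :: "real \<Rightarrow> real \<Rightarrow> (real \<Rightarrow> real) \<Rightarrow> bool" where
  "globally_stable_in_the_large \<beta> A h \<longleftrightarrow>
     (\<forall>x0 X. continuous_solution \<beta> A h x0 X \<longrightarrow> (X \<longlongrightarrow> 0) at_top)"

end

(*
  By the Poisson formula for the kernel t^(beta - 1), at a time T the contribution of the history
  [0, tau] to a solution of u = u0 + I^beta g is an average of u0 and the values of u on [0, tau].
  If u is negative on [0, T) and u T = 0, that average is at most - const * (T - tau)^beta as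
  tau -> T, whereas the integral over [tau, T] is o((T - tau)^beta) when g <= - L u near T:
  a contradiction. So such a u never reaches 0.

  E(t) = E_{beta,1}(c t^beta) solves the linear equation with g = c E. The comparison applied to
  - E gives E > 0, and applied to X - K E and - X - K E with c = A + C and K slightly above |x0|
  it gives |X(t)| <= |x0| E(t). The same bound for linear equations shows that E_{beta,1} is
  increasing on the negative axis, and then the integral equation itself forces E(t) = O(t^(-beta)).
*)

theory Submission
  imports Defs
begin

section \<open>Beta integrals\<close>

text \<open>The substitution theorem and the Beta integral are used with
  \<open>absolutely_integrable_on\<close> over open intervals, the equation with
  \<open>lborel\<close> over closed ones. The endpoints are negligible, and Borel measurability of
  \<open>f\<close> lets integrability descend from the completed measure to
  \<open>lborel\<close>.\<close>

lemma set_integral_Icc_eq_integral_Ioo: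
  fixes f :: "real \<Rightarrow> real"
  assumes f: "f \<in> borel_measurable borel" and ai: "f absolutely_integrable_on {a<..<b}"
  shows "set_integrable lborel {a..b} f"
    and "(LINT s:{a..b}|lborel. f s) = integral {a<..<b} f"
proof -
  have "f absolutely_integrable_on {a..b}"
  proof (subst absolutely_integrable_spike_set_eq)
    show "negligible {x \<in> {a..b} - {a<..<b}. f x \<noteq> 0}"
      by (rule negligible_subset[of "{a, b}"]) auto
    show "negligible {x \<in> {a<..<b} - {a..b}. f x \<noteq> 0}"
      by (rule negligible_subset[of "{}"]) auto
  qed (fact ai)
  then show *: "set_integrable lborel {a..b} f"
    unfolding set_integrable_def by (subst (asm) integrable_completion) (use f in measurable)
  show "(LINT s:{a..b}|lborel. f s) = integral {a<..<b} f"
    using set_borel_integral_eq_integral(2)[OF *] by (simp add: integral_open_interval_real)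
qed

lemma absolutely_integrable_Beta:
  assumes "0 < a" "0 < (b :: real)"
  shows "(\<lambda>y. y powr (a - 1) * (1 - y) powr (b - 1)) absolutely_integrable_on {0<..<1}"
    and "integral {0<..<1} (\<lambda>y. y powr (a - 1) * (1 - y) powr (b - 1)) = Beta a b"
proof -
  have *: "((\<lambda>y. y powr (a - 1) * (1 - y) powr (b - 1)) has_integral Beta a b) {0<..<1}"
    using has_integral_Beta_real[OF assms] by (simp add: has_integral_Icc_iff_Ioo)
  then show "(\<lambda>y. y powr (a - 1) * (1 - y) powr (b - 1)) absolutely_integrable_on {0<..<1}"
    by (intro nonnegative_absolutely_integrable_1) auto
  show "integral {0<..<1} (\<lambda>y. y powr (a - 1) * (1 - y) powr (b - 1)) = Beta a b"
    using * by blast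
qed

text \<open>Carries the result of a substitution over to the wanted integrand, which agrees with it
  up to a factor on \<open>S\<close> but may differ elsewhere.\<close>

lemma absolutely_integrable_cmult_cong:
  fixes f F :: "real \<Rightarrow> real"
  assumes f: "f absolutely_integrable_on S" and F: "\<And>s. s \<in> S \<Longrightarrow> c * f s = F s"
  shows "F absolutely_integrable_on S" and "integral S F = c * integral S f"
proof -
  have "(\<lambda>s. c * f s) absolutely_integrable_on S"
    using f by (simp add: set_integrable_mult_right)
  then show "F absolutely_integrable_on S"
    by (rule absolutely_integrable_spike[of _ _ "{}"]) (simp_all add: F)
  have "integral S F = integral S (\<lambda>s. c * f s)"
    by (rule integral_cong) (simp add: F)
  then show "integral S F = c * integral S f" by simp
qed

text \<open>The substitution y = s / t gives a Beta integral. Divided by \<open>Gamma a\<close>,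
  this is the fractional integral of a power, as it occurs for each term of the Mittag-Leffler
  series.\<close>

lemma powr_Beta_integral:
  fixes a b t :: real
  assumes "0 < a" "0 < b" "0 < t"
  shows "set_integrable lborel {0..t} (\<lambda>s. (t - s) powr (a - 1) * s powr (b - 1))"
    and "(LINT s:{0..t}|lborel. (t - s) powr (a - 1) * s powr (b - 1)) = t powr (a + b - 1) * Beta a b"
proof -
  let ?g = "\<lambda>s. s / t"
  let ?f = "\<lambda>y. y powr (b - 1) * (1 - y) powr (a - 1)"
  let ?F = "\<lambda>s. (t - s) powr (a - 1) * s powr (b - 1)"
  have im: "?g ` {0<..<t} = {0<..<1}"
  proof safe
    fix y :: real assume "y \<in> {0<..<1}"
    then show "y \<in> ?g ` {0<..<t}"
      using assms by (intro image_eqI[of _ _ "y * t"]) auto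
  qed (use assms in auto)
  have ai: "(\<lambda>s. \<bar>1 / t\<bar> * ?f (?g s)) absolutely_integrable_on {0<..<t} \<and>
      integral {0<..<t} (\<lambda>s. \<bar>1 / t\<bar> * ?f (?g s)) = Beta b a"
    by (subst has_absolute_integral_change_of_variables_1')
       (use assms absolutely_integrable_Beta[of b a] im in \<open>auto intro!: derivative_eq_intros inj_onI\<close>)
  have F: "t powr (a + b - 1) * (\<bar>1 / t\<bar> * ?f (?g s)) = ?F s" if "s \<in> {0<..<t}" for s
  proof -
    have "1 - s / t = (t - s) / t" using assms by (simp add: field_simps)
    moreover have "t powr (a + b - 1) = t * (t powr (a - 1) * t powr (b - 1))"
      using assms by (simp add: powr_diff powr_add)
    ultimately show ?thesis
      using that assms by (simp add: powr_divide)
  qed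
  have "?F absolutely_integrable_on {0<..<t}" and "integral {0<..<t} ?F = t powr (a + b - 1) * Beta b a"
    using absolutely_integrable_cmult_cong[OF conjunct1[OF ai] F] unfolding conjunct2[OF ai] by blast+
  with set_integral_Icc_eq_integral_Ioo[of ?F 0 t] show
    "set_integrable lborel {0..t} ?F" "(LINT s:{0..t}|lborel. ?F s) = t powr (a + b - 1) * Beta a b"
    by (auto simp: Beta_commute)
qed

lemma poisson_kernel_integral:
  fixes \<beta> r \<tau> t :: real
  assumes \<beta>: "0 < \<beta>" "\<beta> < 1" and r: "r < \<tau>" "\<tau> < t"
  shows "set_integrable lborel {r..\<tau>} (\<lambda>s. (\<tau> - s) powr (-\<beta>) * (s - r) powr (\<beta> - 1) / (t - s))"
    and "(LINT s:{r..\<tau>}|lborel. (\<tau> - s) powr (-\<beta>) * (s - r) powr (\<beta> - 1) / (t - s)) =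
      Beta \<beta> (1 - \<beta>) * (t - \<tau>) powr (-\<beta>) * (t - r) powr (\<beta> - 1)"
proof -
  \<comment> \<open>The Moebius map with \<open>r \<mapsto> 0\<close>, \<open>\<tau> \<mapsto> 1\<close>, \<open>t \<mapsto> \<infinity>\<close> turns this into a Beta integral.\<close>
  define c where "c = (t - \<tau>) / (\<tau> - r)"
  have c: "0 < c" using r by (simp add: c_def)
  let ?g = "\<lambda>s. c * ((t - r) / (t - s) - 1)"
  let ?g' = "\<lambda>s. c * ((t - r) / (t - s)\<^sup>2)"
  let ?f = "\<lambda>y. y powr (\<beta> - 1) * (1 - y) powr ((1 - \<beta>) - 1)"
  let ?F = "\<lambda>s. (\<tau> - s) powr (-\<beta>) * (s - r) powr (\<beta> - 1) / (t - s)"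
  let ?c = "(t - \<tau>) powr (-\<beta>) * (t - r) powr (\<beta> - 1)"
  have g: "?g s = c * ((s - r) / (t - s))" if "s \<in> {r<..<\<tau>}" for s
    using that r by (simp add: field_simps)
  have one: "1 - ?g s = (t - r) * (\<tau> - s) / ((\<tau> - r) * (t - s))" if "s \<in> {r<..<\<tau>}" for s
  proof -
    have "\<tau> - r \<noteq> 0" "t - s \<noteq> 0" using that r by auto
    then show ?thesis unfolding c_def by (simp add: divide_simps) (simp add: algebra_simps)
  qed
  have im: "?g ` {r<..<\<tau>} = {0<..<1}"
  proof safe
    fix s assume s: "s \<in> {r<..<\<tau>}"
    then have "0 < 1 - ?g s" unfolding one[OF s] using r by simp
    moreover have "0 < ?g s" unfolding g[OF s] using r s c by simp
    ultimately show "?g s \<in> {0<..<1}" by simp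
  next
    fix y :: real assume y: "y \<in> {0<..<1}"
    \<comment> \<open>Solving \<open>?g s = y\<close> for \<open>s\<close> gives this preimage; the
      estimates that follow place it between \<open>r\<close> and \<open>\<tau>\<close>.\<close>
    define s where "s = t - (t - r) / (y / c + 1)"
    have d: "1 < y / c + 1" using y c by simp
    have "(t - \<tau>) * (y / c + 1) < t - r"
    proof -
      have "(t - \<tau>) * (y / c + 1) = y * (\<tau> - r) + (t - \<tau>)" using r by (simp add: c_def field_simps)
      moreover have "y * (\<tau> - r) < 1 * (\<tau> - r)" using y r by (intro mult_strict_right_mono) auto
      ultimately show ?thesis by simp
    qed
    then have "t - \<tau> < (t - r) / (y / c + 1)" using d by (simp add: pos_less_divide_eq)
    then have "s < \<tau>" by (simp add: s_def)
    moreover have "(t - r) * 1 < (t - r) * (y / c + 1)"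
      using d r by (intro mult_strict_left_mono) auto
    then have "(t - r) / (y / c + 1) < t - r" using d by (simp add: pos_divide_less_eq)
    then have "r < s" by (simp add: s_def)
    moreover have "?g s = y" using r d c by (simp add: s_def)
    ultimately show "y \<in> ?g ` {r<..<\<tau>}" by (intro image_eqI[of _ _ s]) auto
  qed
  have der: "(?g has_field_derivative ?g' s) (at s within {r<..<\<tau>})" if "s \<in> {r<..<\<tau>}" for s
  proof -
    have "t - s \<noteq> 0" using that r by auto
    then show ?thesis
      by (auto intro!: derivative_eq_intros simp: power2_eq_square)
  qed
  have inj: "inj_on ?g {r<..<\<tau>}"
    using r c by (intro inj_onI) auto
  have ai: "(\<lambda>s. \<bar>?g' s\<bar> * ?f (?g s)) absolutely_integrable_on {r<..<\<tau>} \<and>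
      integral {r<..<\<tau>} (\<lambda>s. \<bar>?g' s\<bar> * ?f (?g s)) = Beta \<beta> (1 - \<beta>)"
    using has_absolute_integral_change_of_variables_1'[OF _ der inj, of ?f "Beta \<beta> (1 - \<beta>)"]
      absolutely_integrable_Beta[of \<beta> "1 - \<beta>"] im \<beta> by simp
  have F: "?c * (\<bar>?g' s\<bar> * ?f (?g s)) = ?F s" if s: "s \<in> {r<..<\<tau>}" for s
  proof -
    have p: "s - r > 0" "\<tau> - s > 0" "t - s > 0" "t - \<tau> > 0" "t - r > 0" "\<tau> - r > 0"
      using s r by auto
    have i: "x powr (\<beta> - 1) = x powr \<beta> / x" "x powr ((1 - \<beta>) - 1) = 1 / x powr \<beta>" "x powr (- \<beta>) = 1 / x powr \<beta>"
      if "x > 0" for x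
      using that by (auto simp: powr_diff powr_minus field_simps)
    \<comment> \<open>With the differences and their powers named, the claim becomes the rational
      identity \<open>h4\<close>, in which the powers are independent nonzero quantities.\<close>
    define a b d e f where "a = s - r" and "b = \<tau> - s" and "d = t - s" and "e = t - \<tau>" and "f = t - r"
    define k where "k = \<tau> - r"
    have pos: "a > 0" "b > 0" "d > 0" "e > 0" "f > 0" "k > 0"
      using p by (auto simp: a_def b_def d_def e_def f_def k_def)
    have g1: "?g s = e * a / (k * d)" "1 - ?g s = f * b / (k * d)" "\<bar>?g' s\<bar> = e * f / (k * d\<^sup>2)"
      using g[OF s] one[OF s] p c by (simp_all add: a_def b_def d_def e_def f_def k_def c_def)
    have h1: "(e * a / (k * d)) powr (\<beta> - 1) = e powr \<beta> * a powr \<beta> * k * d / (k powr \<beta> * d powr \<beta> * e * a)"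
      using pos by (simp add: i powr_divide powr_mult mult_ac)
    have h2: "(f * b / (k * d)) powr ((1 - \<beta>) - 1) = k powr \<beta> * d powr \<beta> / (f powr \<beta> * b powr \<beta>)"
      using pos by (simp add: powr_divide powr_mult powr_minus divide_simps)
    have h3: "e powr (-\<beta>) = 1 / e powr \<beta>" "f powr (\<beta> - 1) = f powr \<beta> / f"
        "b powr (-\<beta>) = 1 / b powr \<beta>" "a powr (\<beta> - 1) = a powr \<beta> / a"
      using pos i by auto
    have h4: "1 / E * (F / f) * (e * f / (k * d\<^sup>2) * (E * A * k * d / (K * D * e * a) * (K * D / (F * B)))) =
        1 / B * (A / a) / d" if "A \<noteq> 0" "B \<noteq> 0" "D \<noteq> 0" "E \<noteq> 0" "F \<noteq> 0" "K \<noteq> 0" for A B D E F K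
      using that pos by (simp add: power2_eq_square)
    show ?thesis
      \<comment> \<open>\<open>1 - ?g s\<close> contains \<open>?g s\<close>, so it has to be
        rewritten first.\<close>
      unfolding g1(2,3)
      unfolding g1(1)
      unfolding a_def[symmetric] b_def[symmetric] d_def[symmetric] e_def[symmetric] f_def[symmetric] h1 h2 h3
      by (rule h4) (use pos in auto)
  qed
  have "?F absolutely_integrable_on {r<..<\<tau>}" and "integral {r<..<\<tau>} ?F = ?c * Beta \<beta> (1 - \<beta>)"
    using absolutely_integrable_cmult_cong[OF conjunct1[OF ai] F] unfolding conjunct2[OF ai] by blast+
  with set_integral_Icc_eq_integral_Ioo[of ?F r \<tau>] show
    "set_integrable lborel {r..\<tau>} ?F" "(LINT s:{r..\<tau>}|lborel. ?F s) = Beta \<beta> (1 - \<beta>) * (t - \<tau>) powr (-\<beta>) * (t - r) powr (\<beta> - 1)"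
    by (auto simp: mult_ac)
qed

section \<open>The Poisson formula\<close>

text \<open>The forcing \<open>g\<close> stands for A X + h(X), detached from \<open>u\<close>. In
  the pair (g, u) the equation is linear, so a solution of the nonlinear problem can be compared
  with a multiple of a Mittag-Leffler function by subtraction.\<close>

definition volterra :: "real \<Rightarrow> (real \<Rightarrow> real) \<Rightarrow> real \<Rightarrow> (real \<Rightarrow> real) \<Rightarrow> bool" where
  "volterra \<beta> g u0 u \<longleftrightarrow>
     (\<forall>t\<ge>0. set_integrable lborel {0..t} (\<lambda>s. (t - s) powr (\<beta> - 1) * g s) \<and>
        u t = u0 + 1 / Gamma \<beta> * (LINT s:{0..t}|lborel. (t - s) powr (\<beta> - 1) * g s))"

text \<open>At the only point of the domain the kernel is \<open>0 powr a\<close>, which is 0 by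
  convention for every \<open>a\<close>.\<close>

lemma powr_kernel_integral_at_0:
  fixes g :: "real \<Rightarrow> real"
  shows "set_integrable lborel {0..0} (\<lambda>s. (0 - s) powr a * g s)"
    and "(LINT s:{0..0}|lborel. (0 - s) powr a * g s) = 0"
proof -
  have "(\<lambda>s. indicator {0..0} s *\<^sub>R ((0 - s) powr a * g s)) = (\<lambda>_. 0)"
    by (auto simp: fun_eq_iff indicator_def)
  then show "set_integrable lborel {0..0} (\<lambda>s. (0 - s) powr a * g s)"
    and "(LINT s:{0..0}|lborel. (0 - s) powr a * g s) = 0"
    unfolding set_integrable_def set_lebesgue_integral_def by simp_all
qed

lemma volterra_initial_value: "volterra \<beta> g u0 u \<Longrightarrow> u 0 = u0"
  unfolding volterra_def using powr_kernel_integral_at_0(2)[of "\<beta> - 1" g] by auto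

text \<open>
  The normalising constant \<open>1 / Beta \<beta> (1 - \<beta>)\<close> is \<open>sin (\<pi> \<beta>) / \<pi>\<close>.
\<close>

definition poisson_kernel :: "real \<Rightarrow> real \<Rightarrow> real \<Rightarrow> real \<Rightarrow> real" where
  "poisson_kernel \<beta> \<tau> t s = (t - \<tau>) powr \<beta> * ((\<tau> - s) powr (-\<beta>) / (t - s)) / Beta \<beta> (1 - \<beta>)"

lemma Beta_real_pos: "0 < a \<Longrightarrow> 0 < b \<Longrightarrow> 0 < Beta a (b::real)"
  by (simp add: Beta_def)

lemma poisson_kernel_measurable [measurable]: "poisson_kernel \<beta> \<tau> t \<in> borel_measurable borel"
  unfolding poisson_kernel_def by measurable

lemma poisson_kernel_nonneg:
  assumes "0 < \<beta>" "\<beta> < 1" "\<tau> < t" "s \<le> \<tau>"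
  shows "0 \<le> poisson_kernel \<beta> \<tau> t s"
  using assms Beta_real_pos[of \<beta> "1 - \<beta>"] unfolding poisson_kernel_def
  by (intro divide_nonneg_nonneg mult_nonneg_nonneg) auto

text \<open>The property that makes this a Poisson kernel: up to the factor 1 / Gamma(\<beta>), the
  function (s - r)^(\<beta> - 1) is the response to an impulse at time r, and its values on
  [r, \<tau>] are averaged to its value at the later time t.\<close>

lemma poisson_kernel_reproduces:
  assumes \<beta>: "0 < \<beta>" "\<beta> < 1" and r: "r < \<tau>" "\<tau> < t"
  shows "set_integrable lborel {r..\<tau>} (\<lambda>s. poisson_kernel \<beta> \<tau> t s * (s - r) powr (\<beta> - 1))"
    and "(LINT s:{r..\<tau>}|lborel. poisson_kernel \<beta> \<tau> t s * (s - r) powr (\<beta> - 1)) = (t - r) powr (\<beta> - 1)"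
proof -
  let ?c = "(t - \<tau>) powr \<beta> / Beta \<beta> (1 - \<beta>)"
  have eq: "poisson_kernel \<beta> \<tau> t s * (s - r) powr (\<beta> - 1) =
      ?c * ((\<tau> - s) powr (-\<beta>) * (s - r) powr (\<beta> - 1) / (t - s))" for s
    by (simp add: poisson_kernel_def mult_ac)
  show "set_integrable lborel {r..\<tau>} (\<lambda>s. poisson_kernel \<beta> \<tau> t s * (s - r) powr (\<beta> - 1))"
    unfolding eq by (intro set_integrable_mult_right poisson_kernel_integral assms)
  have "Beta \<beta> (1 - \<beta>) \<noteq> 0" using Beta_real_pos[of \<beta> "1 - \<beta>"] \<beta> by simp
  then show "(LINT s:{r..\<tau>}|lborel. poisson_kernel \<beta> \<tau> t s * (s - r) powr (\<beta> - 1)) = (t - r) powr (\<beta> - 1)"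
    unfolding eq set_integral_mult_right poisson_kernel_integral(2)[OF assms]
    using r by (simp add: powr_minus)
qed

lemma poisson_kernel_mass:
  assumes \<beta>: "0 < \<beta>" "\<beta> < 1" and \<tau>: "0 \<le> \<tau>" "\<tau> < t"
  shows "set_integrable lborel {0..\<tau>} (poisson_kernel \<beta> \<tau> t)"
    and "(LINT s:{0..\<tau>}|lborel. poisson_kernel \<beta> \<tau> t s) \<le> 1"
proof -
  let ?w = "poisson_kernel \<beta> \<tau> t"
  \<comment> \<open>Reproduction from \<open>r = -1\<close>; on \<open>{0..\<tau>}\<close> the extra factor \<open>((s + 1) / (t + 1)) powr (\<beta> - 1)\<close> is at least 1.\<close>
  let ?f = "\<lambda>s. (t + 1) powr (1 - \<beta>) * (?w s * (s - -1) powr (\<beta> - 1))"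
  have r: "-1 < \<tau>" using \<tau> by simp
  have i1: "set_integrable lborel {-1..\<tau>} ?f"
    by (intro set_integrable_mult_right poisson_kernel_reproduces(1) \<beta> r \<tau>)
  have i0: "set_integrable lborel {0..\<tau>} ?f"
    by (rule set_integrable_subset[OF i1]) auto
  have le: "?w s \<le> ?f s" if "s \<in> {0..\<tau>}" for s
  proof -
    have "(t + 1) powr (\<beta> - 1) \<le> (s + 1) powr (\<beta> - 1)"
      using that \<tau> \<beta> by (intro powr_mono2') auto
    then have "(t + 1) powr (1 - \<beta>) * (t + 1) powr (\<beta> - 1) \<le> (t + 1) powr (1 - \<beta>) * (s + 1) powr (\<beta> - 1)"
      by (intro mult_left_mono) auto
    moreover have "(t + 1) powr (1 - \<beta>) * (t + 1) powr (\<beta> - 1) = 1"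
      using \<tau> by (simp flip: powr_add)
    ultimately have "?w s * 1 \<le> ?w s * ((t + 1) powr (1 - \<beta>) * (s + 1) powr (\<beta> - 1))"
      using poisson_kernel_nonneg[of \<beta> \<tau> t s] that \<beta> \<tau> by (intro mult_left_mono) auto
    then show ?thesis by (simp add: mult_ac)
  qed
  show i: "set_integrable lborel {0..\<tau>} ?w"
    by (rule set_integrable_bound[OF i0])
       (use le poisson_kernel_nonneg[of \<beta> \<tau> t] \<beta> \<tau> in \<open>auto simp: set_borel_measurable_def abs_of_nonneg intro!: AE_I2 order_trans[OF le]\<close>)
  have "(LINT s:{0..\<tau>}|lborel. ?w s) \<le> (LINT s:{0..\<tau>}|lborel. ?f s)"
    by (rule set_integral_mono[OF i i0]) (use le in auto)
  also have "\<dots> \<le> (LINT s:{-1..\<tau>}|lborel. ?f s)"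
    unfolding set_lebesgue_integral_def
    by (rule integral_mono)
       (use i0 i1 poisson_kernel_nonneg[of \<beta> \<tau> t] \<beta> \<tau> in \<open>auto simp: set_integrable_def indicator_def\<close>)
  also have "\<dots> = 1"
    using \<tau> poisson_kernel_reproduces(2)[OF \<beta> r \<tau>(2)] by (simp flip: powr_add)
  finally show "(LINT s:{0..\<tau>}|lborel. ?w s) \<le> 1" .
qed

text \<open>Every u - u0 is a superposition of impulse responses with density g, and the kernel
  reproduces each of them; Fubini does the rest. Thus the effect at time t of the forcing on
  [0, \<tau>] is expressed through the values of u on [0, \<tau>] alone.\<close>

lemma poisson_representation:
  assumes \<beta>: "0 < \<beta>" "\<beta> < 1" and \<tau>: "0 < \<tau>" "\<tau> < t" and v: "volterra \<beta> g u0 u"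
  shows "set_integrable lborel {0..\<tau>} (\<lambda>s. poisson_kernel \<beta> \<tau> t s * (u s - u0))"
    and "(LINT s:{0..\<tau>}|lborel. poisson_kernel \<beta> \<tau> t s * (u s - u0)) =
      1 / Gamma \<beta> * (LINT s:{0..\<tau>}|lborel. (t - s) powr (\<beta> - 1) * g s)"
proof -
  let ?w = "poisson_kernel \<beta> \<tau> t"
  define G where "G r = indicator {0..\<tau>} r * g r" for r :: real
  define f where "f r s = (if 0 \<le> r \<and> r \<le> s \<and> s \<le> \<tau> then ?w s * (s - r) powr (\<beta> - 1) else 0) * G r" for r s
  have intt: "set_integrable lborel {0..t} (\<lambda>s. (t - s) powr (\<beta> - 1) * g s)"
    using v \<tau> by (auto simp: volterra_def)
  \<comment> \<open>Measurability is known for the kernel times \<open>g\<close> only. On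
    \<open>{0..\<tau>}\<close> the kernel is positive because \<open>\<tau> < t\<close>, so dividing
    by it recovers \<open>g\<close> there.\<close>
  have G_meas [measurable]: "G \<in> borel_measurable borel"
  proof -
    have "(\<lambda>r. indicator {0..t} r *\<^sub>R ((t - r) powr (\<beta> - 1) * g r)) \<in> borel_measurable borel"
      using intt unfolding set_integrable_def by measurable
    then have "(\<lambda>r. indicator {0..\<tau>} r * (indicator {0..t} r *\<^sub>R ((t - r) powr (\<beta> - 1) * g r)) / (t - r) powr (\<beta> - 1))
        \<in> borel_measurable borel" by measurable
    also have "(\<lambda>r. indicator {0..\<tau>} r * (indicator {0..t} r *\<^sub>R ((t - r) powr (\<beta> - 1) * g r)) / (t - r) powr (\<beta> - 1)) = G"
      using \<tau> by (auto simp: fun_eq_iff G_def indicator_def)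
    finally show ?thesis .
  qed
  have f_meas: "case_prod f \<in> borel_measurable (lborel \<Otimes>\<^sub>M lborel)"
    unfolding f_def by measurable
  have f_r: "f r = (\<lambda>s. G r * (indicator {r..\<tau>} s *\<^sub>R (?w s * (s - r) powr (\<beta> - 1))))" for r
    by (auto simp: f_def G_def fun_eq_iff indicator_def)
  \<comment> \<open>The reproduction formula asks for \<open>r < \<tau>\<close>; at
    \<open>r = \<tau>\<close> the interval for \<open>s\<close> collapses to a point. This single
    value is discarded as a null set.\<close>
  have f_int: "integrable lborel (f r)" if "r \<noteq> \<tau>" for r
  proof (cases "r \<in> {0..\<tau>}")
    case True
    then show ?thesis
      using poisson_kernel_reproduces(1)[OF \<beta>, of r \<tau> t] that \<tau>
      unfolding f_r set_integrable_def by (intro integrable_mult_right) auto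
  next
    case False
    then have "f r = (\<lambda>_. 0)" by (auto simp: f_def G_def fun_eq_iff indicator_def)
    then show ?thesis by simp
  qed
  have f_val: "(LINT s|lborel. f r s) = (t - r) powr (\<beta> - 1) * G r" if "r \<noteq> \<tau>" for r
  proof (cases "r \<in> {0..\<tau>}")
    case True
    then show ?thesis
      using poisson_kernel_reproduces(2)[OF \<beta>, of r \<tau> t] that \<tau>
      unfolding f_r set_lebesgue_integral_def by simp
  qed (auto simp: f_def G_def)
  \<comment> \<open>For fixed \<open>r\<close> the sign of \<open>f r s\<close> is that of
    \<open>G r\<close>, since the kernels are nonnegative. So the integral of the absolute value
    follows from \<open>f_val\<close>, and integrability on the product reduces to that of the
    kernel times \<open>G\<close>.\<close>
  have f_norm: "(LINT s|lborel. norm (f r s)) = norm ((t - r) powr (\<beta> - 1) * G r)" if "r \<noteq> \<tau>" for r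
  proof -
    have "norm (f r s) = sgn (G r) * f r s" for s
    proof -
      define k where "k = (if 0 \<le> r \<and> r \<le> s \<and> s \<le> \<tau> then ?w s * (s - r) powr (\<beta> - 1) else 0)"
      have "0 \<le> k" using poisson_kernel_nonneg[OF \<beta> \<tau>(2), of s] by (simp add: k_def)
      moreover have "f r s = k * G r" by (simp add: f_def k_def)
      ultimately show ?thesis
        by (cases "G r" "0 :: real" rule: linorder_cases) (auto simp: abs_mult)
    qed
    then have "(LINT s|lborel. norm (f r s)) = sgn (G r) * (LINT s|lborel. f r s)" by simp
    also have "\<dots> = norm ((t - r) powr (\<beta> - 1) * G r)"
      unfolding f_val[OF that] by (cases "G r" "0 :: real" rule: linorder_cases) (auto simp: abs_mult)
    finally show ?thesis .
  qed
  have kG: "integrable lborel (\<lambda>r. (t - r) powr (\<beta> - 1) * G r)"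
    using set_integrable_subset[OF intt, of "{0..\<tau>}"] \<tau>
    unfolding set_integrable_def G_def by (simp add: mult_ac)
  have AE: "AE r in lborel. r \<noteq> \<tau>" by (rule AE_lborel_singleton)
  have meas_norm: "(\<lambda>r. LINT s|lborel. norm (f r s)) \<in> borel_measurable lborel"
    using f_meas by (intro lborel.borel_measurable_lebesgue_integral) (simp add: case_prod_unfold)
  have "integrable (lborel \<Otimes>\<^sub>M lborel) (case_prod f)"
  proof (rule lborel_pair.Fubini_integrable[OF f_meas])
    have "integrable lborel (\<lambda>r. norm ((t - r) powr (\<beta> - 1) * G r))"
      using kG by (rule integrable_norm)
    then have "integrable lborel (\<lambda>r. LINT s|lborel. norm (f r s))"
      by (rule integrable_cong_AE_imp) (use meas_norm AE f_norm in \<open>auto elim!: eventually_mono\<close>)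
    then show "integrable lborel (\<lambda>r. LINT s|lborel. norm (case_prod f (r, s)))" by simp
    show "AE r in lborel. integrable lborel (\<lambda>s. case_prod f (r, s))"
      using AE f_int by (auto elim!: eventually_mono)
  qed
  note F = this
  \<comment> \<open>In the other order of integration, the inner integral is the equation for
    \<open>u\<close> at time \<open>s\<close>.\<close>
  have snd: "(LINT r|lborel. f r s) = indicator {0..\<tau>} s *\<^sub>R (Gamma \<beta> * (?w s * (u s - u0)))" for s
  proof (cases "s \<in> {0..\<tau>}")
    case True
    have "(LINT r|lborel. f r s) = (LINT r|lborel. ?w s * (indicator {0..s} r *\<^sub>R ((s - r) powr (\<beta> - 1) * g r)))"
      using True by (intro Bochner_Integration.integral_cong) (auto simp: f_def G_def indicator_def)
    also have "\<dots> = ?w s * (LINT r:{0..s}|lborel. (s - r) powr (\<beta> - 1) * g r)"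
      by (simp add: set_lebesgue_integral_def)
    also have "(LINT r:{0..s}|lborel. (s - r) powr (\<beta> - 1) * g r) = Gamma \<beta> * (u s - u0)"
      using v True Gamma_real_pos[OF \<beta>(1)] by (auto simp: volterra_def)
    finally show ?thesis using True by (simp add: mult_ac)
  next
    case False
    then have "f r s = 0" for r by (auto simp: f_def)
    then show ?thesis using False by simp
  qed
  have "integrable lborel (\<lambda>s. LINT r|lborel. f r s)"
    using lborel_pair.integrable_snd[OF F] .
  then have "integrable lborel (\<lambda>s. 1 / Gamma \<beta> * (LINT r|lborel. f r s))"
    by (rule integrable_mult_right)
  then show "set_integrable lborel {0..\<tau>} (\<lambda>s. ?w s * (u s - u0))"
    unfolding snd set_integrable_def using Gamma_real_pos[OF \<beta>(1)] by (simp add: mult_ac)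
  have "(LINT s|lborel. (LINT r|lborel. f r s)) = (LINT r|lborel. (LINT s|lborel. f r s))"
    using F by (rule lborel_pair.Fubini_integral)
  also have "\<dots> = (LINT r|lborel. (t - r) powr (\<beta> - 1) * G r)"
    by (rule integral_cong_AE)
       (use f_meas AE f_val in \<open>auto elim!: eventually_mono intro!: lborel.borel_measurable_lebesgue_integral\<close>)
  also have "\<dots> = (LINT s:{0..\<tau>}|lborel. (t - s) powr (\<beta> - 1) * g s)"
    unfolding set_lebesgue_integral_def G_def by (simp add: mult_ac)
  finally have "Gamma \<beta> * (LINT s:{0..\<tau>}|lborel. ?w s * (u s - u0)) = (LINT s:{0..\<tau>}|lborel. (t - s) powr (\<beta> - 1) * g s)"
    unfolding snd set_lebesgue_integral_def[symmetric] by simp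
  then show "(LINT s:{0..\<tau>}|lborel. ?w s * (u s - u0)) =
      1 / Gamma \<beta> * (LINT s:{0..\<tau>}|lborel. (t - s) powr (\<beta> - 1) * g s)"
    using Gamma_real_pos[OF \<beta>(1)] by (simp add: field_simps)
qed

section \<open>Comparison\<close>

lemma powr_kernel_tail_integral:
  fixes \<beta> \<tau> T :: real
  assumes \<beta>: "0 < \<beta>" and \<tau>: "\<tau> < T"
  shows "set_integrable lborel {\<tau>..T} (\<lambda>s. (T - s) powr (\<beta> - 1))"
    and "(LINT s:{\<tau>..T}|lborel. (T - s) powr (\<beta> - 1)) = (T - \<tau>) powr \<beta> / \<beta>"
proof -
  let ?f = "\<lambda>s. (T - s) powr (\<beta> - 1)" and ?F = "\<lambda>s. - ((T - s) powr \<beta>) / \<beta>"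
  have "(?f has_integral (?F T - ?F \<tau>)) {\<tau>..T}"
  \<comment> \<open>For \<open>\<beta> < 1\<close> the integrand is unbounded near \<open>T\<close>;
    this form of the theorem asks only for continuity of the antiderivative at the
    endpoints.\<close>
  proof (rule fundamental_theorem_of_calculus_interior)
    show "continuous_on {\<tau>..T} ?F"
      using \<beta> by (auto intro!: continuous_intros continuous_on_powr')
    show "(?F has_vector_derivative ?f s) (at s)" if "s \<in> {\<tau><..<T}" for s
      unfolding has_real_derivative_iff_has_vector_derivative[symmetric]
      using that \<beta> by (auto intro!: derivative_eq_intros)
  qed (use \<tau> in auto)
  then have "(?f has_integral (T - \<tau>) powr \<beta> / \<beta>) {\<tau><..<T}"
    using \<beta> by (simp add: has_integral_Icc_iff_Ioo)
  then have "?f absolutely_integrable_on {\<tau><..<T}" "integral {\<tau><..<T} ?f = (T - \<tau>) powr \<beta> / \<beta>"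
    by (auto intro!: nonnegative_absolutely_integrable_1)
  with set_integral_Icc_eq_integral_Ioo[of ?f \<tau> T]
  show "set_integrable lborel {\<tau>..T} ?f" "(LINT s:{\<tau>..T}|lborel. ?f s) = (T - \<tau>) powr \<beta> / \<beta>"
    by auto
qed

text \<open>Both \<tau> - s and T - s are at most T. Apart from (T - \<tau>)^\<beta> the bound does
  not depend on \<tau>, so \<tau> may be moved towards T afterwards.\<close>

lemma poisson_kernel_lower_bound:
  assumes \<beta>: "0 < \<beta>" "\<beta> < 1" and s: "0 \<le> s" "s < \<tau>" "\<tau> < T"
  shows "(T - \<tau>) powr \<beta> * (T powr (-\<beta>) / T / Beta \<beta> (1 - \<beta>)) \<le> poisson_kernel \<beta> \<tau> T s"
proof -
  have "T powr (-\<beta>) / T \<le> (\<tau> - s) powr (-\<beta>) / (T - s)"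
    using assms by (intro frac_le powr_mono2') auto
  then show ?thesis
    using Beta_real_pos[of \<beta> "1 - \<beta>"] \<beta> unfolding poisson_kernel_def times_divide_eq_right[symmetric]
    by (intro mult_left_mono divide_right_mono) auto
qed

text \<open>By the Poisson formula the left-hand side is u0 (1 - mass) plus the kernel average of u.
  The first term is nonpositive because the mass is at most 1. In the second, u is nonpositive
  throughout, and the interval [0, T/2], where u is at most -\<eta>, contributes the stated amount;
  its length T/2 accounts for the 2 in the denominator.\<close>

lemma volterra_history_upper_bound:
  assumes \<beta>: "0 < \<beta>" "\<beta> < 1" and v: "volterra \<beta> g u0 u" and T: "0 < T" and \<eta>: "0 \<le> \<eta>"
    and u0: "u0 \<le> 0" and neg: "\<And>s. s \<in> {0..<T} \<Longrightarrow> u s \<le> 0" and bd: "\<And>s. s \<in> {0..T/2} \<Longrightarrow> u s \<le> -\<eta>"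
    and \<tau>: "T / 2 < \<tau>" "\<tau> < T"
  shows "u0 + 1 / Gamma \<beta> * (LINT s:{0..\<tau>}|lborel. (T - s) powr (\<beta> - 1) * g s)
    \<le> - ((T - \<tau>) powr \<beta> * (\<eta> * T powr (-\<beta>) / (2 * Beta \<beta> (1 - \<beta>))))"
proof -
  let ?w = "poisson_kernel \<beta> \<tau> T"
  let ?c = "(T - \<tau>) powr \<beta> * (T powr (-\<beta>) / T / Beta \<beta> (1 - \<beta>))"
  have \<tau>0: "0 < \<tau>" using T \<tau> by simp
  note P = poisson_representation[OF \<beta> \<tau>0 \<tau>(2) v]
  note M = poisson_kernel_mass[OF \<beta> less_imp_le[OF \<tau>0] \<tau>(2)]
  have iu: "set_integrable lborel {0..\<tau>} (\<lambda>s. ?w s * u s)"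
    using set_integral_add(1)[OF P(1) set_integrable_mult_right[OF M(1), of u0]]
    by (simp add: algebra_simps)
  have "(LINT s:{0..\<tau>}|lborel. ?w s * (u s - u0)) = (LINT s:{0..\<tau>}|lborel. ?w s * u s) - u0 * (LINT s:{0..\<tau>}|lborel. ?w s)"
    using set_integral_diff(2)[OF iu set_integrable_mult_right[OF M(1), of u0]]
    by (simp add: algebra_simps)
  moreover have "u0 * 1 \<le> u0 * (LINT s:{0..\<tau>}|lborel. ?w s)"
    using M(2) u0 by (intro mult_left_mono_neg) auto
  ultimately have "u0 + 1 / Gamma \<beta> * (LINT s:{0..\<tau>}|lborel. (T - s) powr (\<beta> - 1) * g s) \<le> (LINT s:{0..\<tau>}|lborel. ?w s * u s)"
    using P(2) by simp
  also have "\<dots> \<le> (LINT s:{0..T/2}|lborel. ?c * (-\<eta>))"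
    unfolding set_lebesgue_integral_def
  proof (rule integral_mono)
    show "integrable lborel (\<lambda>s. indicator {0..\<tau>} s *\<^sub>R (?w s * u s))"
      using iu by (simp add: set_integrable_def)
    show "integrable lborel (\<lambda>s. indicator {0..T/2} s *\<^sub>R (?c * (-\<eta>)))"
      by (intro integrable_scaleR_left integrable_real_indicator) (auto simp: emeasure_lborel_Icc_eq)
    fix s
    show "indicator {0..\<tau>} s *\<^sub>R (?w s * u s) \<le> indicator {0..T/2} s *\<^sub>R (?c * (-\<eta>))"
    proof (cases "s \<in> {0..T/2}")
      case True
      then have "?c * \<eta> \<le> ?w s * (- u s)"
        using poisson_kernel_lower_bound[OF \<beta>, of s \<tau> T] \<tau> T bd[OF True] \<eta> poisson_kernel_nonneg[OF \<beta> \<tau>(2), of s]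
        by (intro mult_mono) auto
      then show ?thesis using True \<tau> by simp
    next
      case False
      then show ?thesis
        using neg[of s] \<tau> poisson_kernel_nonneg[OF \<beta> \<tau>(2), of s]
        by (auto simp: indicator_def mult_nonneg_nonpos)
    qed
  qed
  also have "\<dots> = - ((T - \<tau>) powr \<beta> * (\<eta> * T powr (-\<beta>) / (2 * Beta \<beta> (1 - \<beta>))))"
    using T unfolding set_lebesgue_integral_def by (simp add: field_simps)
  finally show ?thesis .
qed

lemma volterra_no_first_zero:
  assumes \<beta>: "0 < \<beta>" "\<beta> < 1" and v: "volterra \<beta> g u0 u" and cont: "continuous_on {0..} u"
    and u0: "u0 < 0" and T: "0 < T" "u T = 0" and neg: "\<And>s. s \<in> {0..<T} \<Longrightarrow> u s < 0"
    and L: "0 \<le> L" and a: "a < T" and g: "\<And>s. 0 \<le> s \<Longrightarrow> a \<le> s \<Longrightarrow> s \<le> T \<Longrightarrow> g s \<le> L * (- u s)"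
  shows False
proof -
  \<comment> \<open>Compactness of \<open>{0..T/2}\<close> turns the strict negativity of
    \<open>u\<close> into a uniform bound \<open>-\<eta>\<close>.\<close>
  obtain x where x: "x \<in> {0..T/2}" "\<And>s. s \<in> {0..T/2} \<Longrightarrow> u s \<le> u x"
    using continuous_attains_sup[of "{0..T/2}" u] continuous_on_subset[OF cont, of "{0..T/2}"] T by auto
  define \<eta> where "\<eta> = - u x"
  have \<eta>: "0 < \<eta>" using neg[of x] x T by (simp add: \<eta>_def)
  define \<kappa> where "\<kappa> = \<eta> * T powr (-\<beta>) / (2 * Beta \<beta> (1 - \<beta>))"
  have \<kappa>: "0 < \<kappa>" using \<eta> T Beta_real_pos[of \<beta> "1 - \<beta>"] \<beta> by (simp add: \<kappa>_def)
  have G: "0 < Gamma \<beta>" using \<beta> by simp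
  \<comment> \<open>If |u| is below \<open>\<epsilon>\<close> on the tail, the tail contributes at
    most L / (L + 1) times \<kappa> (T - \<tau>)^\<beta>, which is strictly less than what the
    history takes away. Dividing by L + 1 also covers L = 0.\<close>
  define \<epsilon> where "\<epsilon> = \<kappa> * \<beta> * Gamma \<beta> / (L + 1)"
  have \<epsilon>: "0 < \<epsilon>" using \<kappa> \<beta> G L by (simp add: \<epsilon>_def)
  obtain d where d: "0 < d" "\<And>s. s \<in> {0..} \<Longrightarrow> dist s T < d \<Longrightarrow> dist (u s) (u T) < \<epsilon>"
    using cont T \<epsilon> unfolding continuous_on_iff by (metis atLeast_iff less_imp_le)
  \<comment> \<open>Beyond \<open>a\<close> the bound on \<open>g\<close> holds, beyond
    \<open>T - d\<close> the values of \<open>u\<close> are small, and beyond \<open>T / 2\<close>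
    the history bound applies.\<close>
  define \<tau>0 where "\<tau>0 = max (max a (T - d)) (T / 2)"
  have "\<tau>0 < T" using a d T by (auto simp: \<tau>0_def)
  then obtain \<tau> where \<tau>': "\<tau>0 < \<tau>" "\<tau> < T" using dense by blast
  then have \<tau>: "a < \<tau>" "T - d < \<tau>" "T / 2 < \<tau>" "\<tau> < T" by (auto simp: \<tau>0_def)
  let ?k = "\<lambda>s. (T - s) powr (\<beta> - 1)"
  have int: "set_integrable lborel {0..T} (\<lambda>s. ?k s * g s)"
    and uT: "u T = u0 + 1 / Gamma \<beta> * (LINT s:{0..T}|lborel. ?k s * g s)"
    using v T by (auto simp: volterra_def)
  have i1: "set_integrable lborel {0..\<tau>} (\<lambda>s. ?k s * g s)"
    and i2: "set_integrable lborel {\<tau><..T} (\<lambda>s. ?k s * g s)"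
    using \<tau> T by (auto intro!: set_integrable_subset[OF int])
  have "{0..T} = {0..\<tau>} \<union> {\<tau><..T}" using \<tau> T by auto
  moreover have "{0..\<tau>} \<inter> {\<tau><..T} = {}" by auto
  ultimately have split: "(LINT s:{0..T}|lborel. ?k s * g s) = (LINT s:{0..\<tau>}|lborel. ?k s * g s) + (LINT s:{\<tau><..T}|lborel. ?k s * g s)"
    using set_integral_Un[OF _ i1 i2] by simp
  note K = powr_kernel_tail_integral[OF \<beta>(1) \<tau>(4)]
  have "(LINT s:{\<tau><..T}|lborel. ?k s * g s) \<le> (LINT s:{\<tau>..T}|lborel. (L * \<epsilon>) * ?k s)"
    unfolding set_lebesgue_integral_def
  proof (rule integral_mono)
    show "integrable lborel (\<lambda>s. indicator {\<tau><..T} s *\<^sub>R (?k s * g s))"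
      using i2 by (simp add: set_integrable_def)
    show "integrable lborel (\<lambda>s. indicator {\<tau>..T} s *\<^sub>R ((L * \<epsilon>) * ?k s))"
      using set_integrable_mult_right[OF K(1), of "L * \<epsilon>"] unfolding set_integrable_def by simp
    fix s
    show "indicator {\<tau><..T} s *\<^sub>R (?k s * g s) \<le> indicator {\<tau>..T} s *\<^sub>R ((L * \<epsilon>) * ?k s)"
    proof (cases "s \<in> {\<tau><..T}")
      case True
      have "\<bar>u s\<bar> < \<epsilon>" using d(2)[of s] True \<tau> T by (auto simp: dist_real_def)
      then have "L * (- u s) \<le> L * \<epsilon>" using L by (intro mult_left_mono) auto
      moreover have "g s \<le> L * (- u s)" using g True \<tau> T by auto
      ultimately have "g s \<le> L * \<epsilon>" by linarith
      then have "?k s * g s \<le> ?k s * (L * \<epsilon>)" by (intro mult_left_mono) auto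
      then show ?thesis using True by (simp add: mult_ac)
    next
      case False
      then show ?thesis using L \<epsilon> by (simp add: indicator_def)
    qed
  qed
  also have "\<dots> = L * \<epsilon> * ((T - \<tau>) powr \<beta> / \<beta>)"
    using K(2) by simp
  also have "\<dots> = L / (L + 1) * ((T - \<tau>) powr \<beta> * \<kappa> * Gamma \<beta>)"
    using L \<beta> by (simp add: \<epsilon>_def field_simps)
  also have "\<dots> < 1 * ((T - \<tau>) powr \<beta> * \<kappa> * Gamma \<beta>)"
    using L \<kappa> G \<tau> by (intro mult_strict_right_mono) auto
  finally have tail: "1 / Gamma \<beta> * (LINT s:{\<tau><..T}|lborel. ?k s * g s) < (T - \<tau>) powr \<beta> * \<kappa>"
    using G by (simp add: field_simps)
  have "u0 + 1 / Gamma \<beta> * (LINT s:{0..\<tau>}|lborel. ?k s * g s) \<le> - ((T - \<tau>) powr \<beta> * \<kappa>)"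
    unfolding \<kappa>_def using volterra_history_upper_bound[OF \<beta> v T(1) _ _ _ _ \<tau>(3,4), of \<eta>] \<eta> u0 neg x
    by (force simp: \<eta>_def less_imp_le)
  then have "u T < 0"
    unfolding uT split using tail by (simp add: distrib_left)
  then show False using T by simp
qed

text \<open>Otherwise there is a least time T with u T nonnegative, and it would be a first zero.
  The bound on g is asked for only just before such a T: in the application, the nonlinearity is
  controlled only while the solution is positive and small, which is known near a touching
  time.\<close>

lemma volterra_strict_comparison:
  assumes \<beta>: "0 < \<beta>" "\<beta> < 1" and v: "volterra \<beta> g u0 u" and cont: "continuous_on {0..} u"
    and u0: "u0 < 0" and L: "0 \<le> L"
    and g: "\<And>T. 0 < T \<Longrightarrow> u T = 0 \<Longrightarrow> (\<And>s. s \<in> {0..<T} \<Longrightarrow> u s < 0) \<Longrightarrow>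
      \<exists>a<T. \<forall>s. 0 \<le> s \<longrightarrow> a \<le> s \<longrightarrow> s \<le> T \<longrightarrow> g s \<le> L * (- u s)"
    and t: "0 \<le> t"
  shows "u t < 0"
proof (rule ccontr)
  assume "\<not> u t < 0"
  define S where "S = {0..} \<inter> u -` {0..}"
  have "t \<in> S" using t \<open>\<not> u t < 0\<close> by (simp add: S_def)
  have "closed S" unfolding S_def by (intro continuous_closed_preimage cont) auto
  moreover have bdd: "bdd_below S" by (rule bdd_belowI[of _ 0]) (simp add: S_def)
  ultimately have T: "Inf S \<in> S" using \<open>t \<in> S\<close> closed_contains_Inf by blast
  define T where "T = Inf S"
  have first: "u s < 0" if "s \<in> {0..<T}" for s
    using that cInf_lower[OF _ bdd, of s] by (force simp: T_def S_def)
  have u_0: "u 0 = u0" using v by (rule volterra_initial_value)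
  have T': "0 \<le> T" "0 \<le> u T" using T by (auto simp: T_def S_def)
  \<comment> \<open>A zero in \<open>{0..T}\<close> exists by the intermediate value theorem; as
    \<open>u\<close> is negative before \<open>T\<close>, it must be \<open>T\<close>
    itself.\<close>
  obtain x where x: "0 \<le> x" "x \<le> T" "u x = 0"
    using IVT'[of u 0 0 T] T' u_0 u0 continuous_on_subset[OF cont, of "{0..T}"] by auto
  then have uT: "u T = 0" using first[of x] by (cases "x = T") auto
  moreover have "T \<noteq> 0" using uT u_0 u0 by auto
  ultimately obtain a where "a < T" "\<And>s. 0 \<le> s \<Longrightarrow> a \<le> s \<Longrightarrow> s \<le> T \<Longrightarrow> g s \<le> L * (- u s)"
    using g[of T] first T' by force
  then show False
    using volterra_no_first_zero[OF \<beta> v cont u0 _ uT first L] T' \<open>T \<noteq> 0\<close> by auto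
qed

section \<open>The Mittag-Leffler function\<close>

text \<open>Log-convexity of Gamma: with y = x + \<beta> - 1, the point x is the convex combination
  of y + 1 and y with weights 1 - \<beta> and \<beta>, and Gamma(y + 1) = y Gamma(y).\<close>

lemma Gamma_powr_le:
  fixes x \<beta> :: real
  assumes "0 < \<beta>" "\<beta> < 1" "1 \<le> x"
  shows "Gamma x * (x + \<beta> - 1) powr \<beta> \<le> Gamma (x + \<beta>)"
proof -
  define y where "y = x + \<beta> - 1"
  have y: "0 < y" and x: "x + \<beta> = y + 1" using assms by (auto simp: y_def)
  have "(ln \<circ> Gamma) ((1 - \<beta>) *\<^sub>R (y + 1) + \<beta> *\<^sub>R y) \<le> (1 - \<beta>) * (ln \<circ> Gamma) (y + 1) + \<beta> * (ln \<circ> Gamma) y"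
    using assms y by (intro convex_onD[OF log_convex_Gamma_real]) auto
  moreover have "(1 - \<beta>) *\<^sub>R (y + 1) + \<beta> *\<^sub>R y = x" by (simp add: y_def algebra_simps)
  moreover have "Gamma (y + 1) = y * Gamma y" using y by (intro Gamma_plus1) (auto elim!: nonpos_Ints_cases')
  ultimately have "ln (Gamma x) + \<beta> * ln y \<le> ln (Gamma (y + 1))"
    using y Gamma_real_pos[OF y, THEN less_imp_neq] by (simp add: ln_mult algebra_simps)
  moreover have "ln (Gamma x * y powr \<beta>) = ln (Gamma x) + \<beta> * ln y"
    using y assms Gamma_real_pos[of x, THEN less_imp_neq] by (simp add: ln_mult ln_powr)
  ultimately have "Gamma x * y powr \<beta> \<le> Gamma (y + 1)"
    using y assms by (subst ln_le_cancel_iff[symmetric]) auto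
  then show ?thesis by (simp add: x y_def[symmetric])
qed

text \<open>Ratio test: by \<open>Gamma_powr_le\<close>, consecutive Gamma values have a quotient of
  at least (\<beta> (k + 1))^\<beta>, which tends to infinity and eventually exceeds 2 |z|.\<close>

lemma mittag_leffler_summable:
  fixes \<beta> z :: real
  assumes \<beta>: "0 < \<beta>" "\<beta> < 1"
  shows "summable (\<lambda>k. (1 / Gamma (real k * \<beta> + 1)) * z ^ k)"
proof -
  obtain N :: nat where N0: "(2 * \<bar>z\<bar> + 1) powr (1 / \<beta>) / \<beta> \<le> real N"
    using real_arch_simple by blast
  have N: "2 * \<bar>z\<bar> + 1 \<le> (\<beta> * (real k + 1)) powr \<beta>" if "N \<le> k" for k
  proof -
    have "(2 * \<bar>z\<bar> + 1) powr (1 / \<beta>) \<le> \<beta> * real N" using N0 \<beta> by (simp add: field_simps)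
    also have "\<dots> \<le> \<beta> * (real k + 1)" using that \<beta> by (intro mult_left_mono) auto
    finally have "((2 * \<bar>z\<bar> + 1) powr (1 / \<beta>)) powr \<beta> \<le> (\<beta> * (real k + 1)) powr \<beta>"
      using \<beta> by (intro powr_mono2) auto
    then show ?thesis using \<beta> by (simp add: powr_powr)
  qed
  show ?thesis
  proof (rule summable_ratio_test[of "1/2" N])
    fix k assume "N \<le> k"
    define a b p where "a = Gamma (real k * \<beta> + 1)" and "b = Gamma (real (Suc k) * \<beta> + 1)" and "p = (\<beta> * (real k + 1)) powr \<beta>"
    have ab: "0 < a" "0 < b" using \<beta> by (auto simp: a_def b_def intro!: Gamma_real_pos add_nonneg_pos)
    have "a * p \<le> b"
      using Gamma_powr_le[OF \<beta>, of "real k * \<beta> + 1"] \<beta> by (simp add: a_def b_def p_def algebra_simps)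
    moreover have "a * (2 * \<bar>z\<bar>) \<le> a * p" using N[OF \<open>N \<le> k\<close>] ab by (intro mult_left_mono) (auto simp: p_def)
    ultimately have "a * (2 * \<bar>z\<bar>) \<le> b" by (rule order_trans[rotated])
    then have "\<bar>z\<bar> / b \<le> 1 / 2 * (1 / a)" using ab by (simp add: field_simps)
    then have "\<bar>z\<bar> ^ k * (\<bar>z\<bar> / b) \<le> \<bar>z\<bar> ^ k * (1 / 2 * (1 / a))" by (intro mult_left_mono) auto
    then show "norm (1 / Gamma (real (Suc k) * \<beta> + 1) * z ^ Suc k) \<le> 1 / 2 * norm (1 / Gamma (real k * \<beta> + 1) * z ^ k)"
      unfolding a_def[symmetric] b_def[symmetric] using ab by (simp add: abs_mult power_abs mult_ac)
  qed simp
qed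

lemma mittag_leffler_altdef: "mittag_leffler \<beta> 1 z = (\<Sum>k. (1 / Gamma (real k * \<beta> + 1)) * z ^ k)"
  by (simp add: mittag_leffler_def)

lemma mittag_leffler_0: "mittag_leffler \<beta> 1 0 = 1"
  unfolding mittag_leffler_altdef powser_zero by simp

lemma continuous_mittag_leffler:
  assumes "0 < \<beta>" "\<beta> < 1"
  shows "continuous_on UNIV (mittag_leffler \<beta> 1)"
proof -
  have "isCont (\<lambda>x. \<Sum>k. (1 / Gamma (real k * \<beta> + 1)) * x ^ k) x" for x
    by (rule isCont_powser_converges_everywhere) (rule mittag_leffler_summable[OF assms])
  then show ?thesis
    by (simp add: continuous_on_eq_continuous_at mittag_leffler_altdef[abs_def])
qed

lemma continuous_mittag_leffler_powr:
  assumes "0 < \<beta>" "\<beta> < 1"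
  shows "continuous_on {0..} (\<lambda>t. mittag_leffler \<beta> 1 (c * t powr \<beta>))"
  using assms
  by (intro continuous_on_compose2[OF continuous_mittag_leffler[OF assms]] continuous_intros continuous_on_powr') auto

text \<open>Fractional integration of c times the k-th term of the series gives the term with index
  k + 1, so the integral of the whole series is the series without its initial term 1. The
  interchange is justified by absolute convergence.\<close>

lemma volterra_mittag_leffler:
  assumes \<beta>: "0 < \<beta>" "\<beta> < 1"
  shows "volterra \<beta> (\<lambda>t. c * mittag_leffler \<beta> 1 (c * t powr \<beta>)) 1 (\<lambda>t. mittag_leffler \<beta> 1 (c * t powr \<beta>))"
  unfolding volterra_def
proof (intro allI impI)
  fix t :: real assume "0 \<le> t"
  let ?E = "\<lambda>t. mittag_leffler \<beta> 1 (c * t powr \<beta>)"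
  show "set_integrable lborel {0..t} (\<lambda>s. (t - s) powr (\<beta> - 1) * (c * ?E s)) \<and>
      ?E t = 1 + 1 / Gamma \<beta> * (LINT s:{0..t}|lborel. (t - s) powr (\<beta> - 1) * (c * ?E s))"
  proof (cases "t = 0")
    case True
    show ?thesis
      using powr_kernel_integral_at_0[of "\<beta> - 1" "\<lambda>s. c * ?E s"] \<beta> unfolding True by (simp add: mittag_leffler_0)
  next
    case False
    with \<open>0 \<le> t\<close> have t: "0 < t" by simp
    define a where "a k = 1 / Gamma (real k * \<beta> + 1)" for k
    let ?e = "\<lambda>k. a k * (c * t powr \<beta>) ^ k"
    have a: "0 < a k" for k using \<beta> by (auto simp: a_def intro!: Gamma_real_pos add_nonneg_pos)
    define f where "f k s = indicator {0..t} s *\<^sub>R ((t - s) powr (\<beta> - 1) * (c * (a k * (c * s powr \<beta>) ^ k)))" for k s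
    \<comment> \<open>At \<open>s = 0\<close> and \<open>k = 0\<close> the two sides may differ: a
      natural power with exponent 0 is 1, but \<open>0 powr 0\<close> is 0.\<close>
    have f: "f k s = (c * (a k * c ^ k)) * (indicator {0..t} s *\<^sub>R ((t - s) powr (\<beta> - 1) * s powr ((real k * \<beta> + 1) - 1)))"
      if "s \<noteq> 0" for k s
      using that by (simp add: f_def power_mult_distrib powr_power mult_ac)
    have p: "0 < real k * \<beta> + 1" for k using \<beta> by (simp add: add_nonneg_pos)
    note B = powr_Beta_integral[OF \<beta>(1) p t]
    have AE: "AE s in lborel. s \<noteq> (0::real)" by (rule AE_lborel_singleton)
    have f_meas [measurable]: "f k \<in> borel_measurable lborel" for k unfolding f_def by measurable
    let ?h = "\<lambda>k s. indicator {0..t} s *\<^sub>R ((t - s) powr (\<beta> - 1) * s powr ((real k * \<beta> + 1) - 1))"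
    have h: "integrable lborel (?h k)" for k using B(1) by (simp add: set_integrable_def)
    have f_int: "integrable lborel (f k)" for k
      by (rule integrable_cong_AE_imp[OF integrable_mult_right[OF h, of "c * (a k * c ^ k)"]])
         (use AE f in \<open>auto elim!: eventually_mono\<close>)
    have val: "a k * (t powr (\<beta> + (real k * \<beta> + 1) - 1) * Beta \<beta> (real k * \<beta> + 1)) = Gamma \<beta> * (a (Suc k) * (t powr \<beta>) ^ Suc k)" for k
    proof -
      have "t powr (\<beta> + (real k * \<beta> + 1) - 1) = (t powr \<beta>) ^ Suc k"
        using t by (subst powr_power) (auto simp: algebra_simps)
      moreover have "a k * Beta \<beta> (real k * \<beta> + 1) = Gamma \<beta> * a (Suc k)"
        using a[of k] by (simp add: a_def Beta_def algebra_simps)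
      ultimately show ?thesis by (simp add: mult_ac)
    qed
    have f_val: "(LINT s|lborel. f k s) = Gamma \<beta> * ?e (Suc k)" for k
    proof -
      have "(LINT s|lborel. f k s) = (LINT s|lborel. (c * (a k * c ^ k)) * ?h k s)"
        by (rule integral_cong_AE) (use AE f in \<open>auto elim!: eventually_mono\<close>)
      also have "\<dots> = c ^ Suc k * (a k * (t powr (\<beta> + (real k * \<beta> + 1) - 1) * Beta \<beta> (real k * \<beta> + 1)))"
        using B(2)[of k] by (simp add: set_lebesgue_integral_def)
      also have "\<dots> = Gamma \<beta> * ?e (Suc k)"
        unfolding val by (simp add: power_mult_distrib mult_ac)
      finally show ?thesis .
    qed
    \<comment> \<open>Each term has constant sign on the interval, so the same computation with |c|
      applies; summability becomes absolute convergence of the series at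
      \<open>c * t powr \<beta>\<close>.\<close>
    have f_norm: "(LINT s|lborel. norm (f k s)) = Gamma \<beta> * norm (?e (Suc k))" for k
    proof -
      have "(LINT s|lborel. norm (f k s)) = (LINT s|lborel. \<bar>c * (a k * c ^ k)\<bar> * ?h k s)"
        by (rule integral_cong_AE) (use AE f in \<open>auto elim!: eventually_mono simp: abs_mult indicator_def\<close>)
      also have "\<dots> = \<bar>c\<bar> ^ Suc k * (a k * (t powr (\<beta> + (real k * \<beta> + 1) - 1) * Beta \<beta> (real k * \<beta> + 1)))"
        using B(2)[of k] a[of k] by (simp add: set_lebesgue_integral_def abs_mult power_abs)
      also have "\<dots> = Gamma \<beta> * norm (?e (Suc k))"
        unfolding val using a[of "Suc k"] by (simp add: power_mult_distrib mult_ac abs_mult power_abs)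
      finally show ?thesis .
    qed
    have summ: "summable ?e" and summ_norm: "summable (\<lambda>k. norm (?e k))"
      using mittag_leffler_summable[OF \<beta>, of "c * t powr \<beta>"] mittag_leffler_summable[OF \<beta>, of "\<bar>c * t powr \<beta>\<bar>"] less_imp_le[OF a]
      by (auto simp: a_def[symmetric] abs_mult power_abs)
    have pt: "summable (\<lambda>k. norm (f k s))" for s
    proof -
      have "summable (\<lambda>k. (indicator {0..t} s * ((t - s) powr (\<beta> - 1) * \<bar>c\<bar>)) * (a k * \<bar>c * s powr \<beta>\<bar> ^ k))"
        using mittag_leffler_summable[OF \<beta>, of "\<bar>c * s powr \<beta>\<bar>"] unfolding a_def by (rule summable_mult)
      also have "(\<lambda>k. (indicator {0..t} s * ((t - s) powr (\<beta> - 1) * \<bar>c\<bar>)) * (a k * \<bar>c * s powr \<beta>\<bar> ^ k)) = (\<lambda>k. norm (f k s))"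
        using less_imp_le[OF a] by (auto simp: f_def fun_eq_iff indicator_def abs_mult power_abs)
      finally show ?thesis .
    qed
    have sum_f: "(\<Sum>k. f k s) = indicator {0..t} s *\<^sub>R ((t - s) powr (\<beta> - 1) * (c * ?E s))" for s
    proof -
      have "(\<lambda>k. a k * (c * s powr \<beta>) ^ k) sums ?E s"
        using summable_sums[OF mittag_leffler_summable[OF \<beta>, of "c * s powr \<beta>"]]
        unfolding a_def mittag_leffler_altdef .
      then have "(\<lambda>k. f k s) sums (indicator {0..t} s *\<^sub>R ((t - s) powr (\<beta> - 1) * (c * ?E s)))"
        unfolding f_def by (intro sums_scaleR_right sums_mult)
      then show ?thesis by (rule sums_unique[symmetric])
    qed
    have sn: "summable (\<lambda>k. LINT s|lborel. norm (f k s))"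
      unfolding f_norm using summ_norm by (intro summable_mult) (rule summable_Suc_iff[of "\<lambda>k. norm (?e k)", THEN iffD2])
    have int: "integrable lborel (\<lambda>s. \<Sum>k. f k s)"
      and sums: "(\<lambda>k. LINT s|lborel. f k s) sums (LINT s|lborel. (\<Sum>k. f k s))"
      using f_int pt sn by (auto intro!: integrable_suminf sums_integral)
    have "(\<lambda>k. Gamma \<beta> * ?e (Suc k)) sums (Gamma \<beta> * (?E t - 1))"
    proof (intro sums_mult)
      have "?e sums ?E t" using summ by (simp add: a_def mittag_leffler_altdef summable_sums)
      moreover have "?e 0 = 1" by (simp add: a_def)
      ultimately show "(\<lambda>k. ?e (Suc k)) sums (?E t - 1)" unfolding sums_Suc_iff[of ?e] by simp
    qed
    then have "(LINT s|lborel. (\<Sum>k. f k s)) = Gamma \<beta> * (?E t - 1)"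
      using sums_unique2[OF sums] unfolding f_val by simp
    then show ?thesis
      using int Gamma_real_pos[OF \<beta>(1)] unfolding sum_f set_integrable_def set_lebesgue_integral_def by simp
  qed
qed

section \<open>Stability\<close>

lemma volterra_scale:
  assumes "volterra \<beta> g u0 u"
  shows "volterra \<beta> (\<lambda>s. c * g s) (c * u0) (\<lambda>t. c * u t)"
proof -
  have eq: "(t - s) powr (\<beta> - 1) * (c * g s) = c * ((t - s) powr (\<beta> - 1) * g s)" for t s
    by simp
  show ?thesis
    using assms unfolding volterra_def eq by (auto simp: algebra_simps simp del: mult.left_commute)
qed

lemma volterra_diff:
  assumes "volterra \<beta> g u0 u" "volterra \<beta> g' u0' u'"
  shows "volterra \<beta> (\<lambda>s. g s - g' s) (u0 - u0') (\<lambda>t. u t - u' t)"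
  unfolding volterra_def
proof (intro allI impI)
  fix t :: real assume t: "0 \<le> t"
  let ?k = "\<lambda>s. (t - s) powr (\<beta> - 1)"
  have i: "set_integrable lborel {0..t} (\<lambda>s. ?k s * g s)" "set_integrable lborel {0..t} (\<lambda>s. ?k s * g' s)"
    and u: "u t = u0 + 1 / Gamma \<beta> * (LINT s:{0..t}|lborel. ?k s * g s)"
      "u' t = u0' + 1 / Gamma \<beta> * (LINT s:{0..t}|lborel. ?k s * g' s)"
    using assms t by (auto simp: volterra_def)
  show "set_integrable lborel {0..t} (\<lambda>s. ?k s * (g s - g' s)) \<and>
      u t - u' t = u0 - u0' + 1 / Gamma \<beta> * (LINT s:{0..t}|lborel. ?k s * (g s - g' s))"
    using set_integral_diff[OF i] unfolding u right_diff_distrib by (simp add: diff_divide_distrib)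
qed

text \<open>For u = -E the forcing is -c E = L (-u) with L = -c, so the comparison hypothesis holds
  with equality.\<close>

lemma mittag_leffler_powr_pos:
  assumes \<beta>: "0 < \<beta>" "\<beta> < 1" and c: "c \<le> 0" and t: "0 \<le> t"
  shows "0 < mittag_leffler \<beta> 1 (c * t powr \<beta>)"
proof -
  let ?E = "\<lambda>t. mittag_leffler \<beta> 1 (c * t powr \<beta>)"
  have "- 1 * ?E t < 0"
  proof (rule volterra_strict_comparison[OF \<beta> volterra_scale[OF volterra_mittag_leffler[OF \<beta>]] _ _ _ _ t])
    show "continuous_on {0..} (\<lambda>t. - 1 * ?E t)"
      by (intro continuous_intros continuous_mittag_leffler_powr \<beta>)
    show "0 \<le> - c" using c by simp
    show "\<exists>a<T. \<forall>s. 0 \<le> s \<longrightarrow> a \<le> s \<longrightarrow> s \<le> T \<longrightarrow> - 1 * (c * ?E s) \<le> - c * - (- 1 * ?E s)" for T :: real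
      by (intro exI[of _ "T - 1"]) simp
  qed simp
  then show ?thesis by simp
qed

text \<open>At time 1 the argument of the Mittag-Leffler function is z itself, and by positivity the
  forcing z E in the integral equation is nonpositive.\<close>

lemma mittag_leffler_le_1:
  assumes \<beta>: "0 < \<beta>" "\<beta> < 1" and z: "z \<le> 0"
  shows "mittag_leffler \<beta> 1 z \<le> 1"
proof -
  let ?g = "\<lambda>s. (1 - s) powr (\<beta> - 1) * (z * mittag_leffler \<beta> 1 (z * s powr \<beta>))"
  have "mittag_leffler \<beta> 1 (z * 1 powr \<beta>) = 1 + 1 / Gamma \<beta> * (LINT s:{0..1}|lborel. ?g s)"
    using volterra_mittag_leffler[OF \<beta>, of z, unfolded volterra_def, THEN spec, of 1] by simp_all
  moreover have "0 \<le> (LINT s:{0..1}|lborel. - ?g s)"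
    unfolding set_lebesgue_integral_def
    by (rule integral_nonneg_AE)
       (use mittag_leffler_powr_pos[OF \<beta> z] z in \<open>auto simp: indicator_def mult_nonneg_nonpos mult_nonpos_nonneg less_imp_le intro!: AE_I2\<close>)
  then have "(LINT s:{0..1}|lborel. ?g s) \<le> 0" by (simp add: set_lebesgue_integral_def)
  then have "1 / Gamma \<beta> * (LINT s:{0..1}|lborel. ?g s) \<le> 0"
    using \<beta> by (intro mult_nonneg_nonpos) auto
  ultimately show ?thesis by simp
qed

section \<open>Comparison of solutions with Mittag-Leffler functions\<close>

text \<open>X is compared with c E for |x0| < c < d, and c then decreases to |x0|. Since E is at
  most 1, X stays below c < d up to a first touching time, so the local bound on h applies. The
  statement is one-sided so that it serves for both X and -X.\<close>

lemma volterra_mittag_leffler_upper_bound: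
  assumes \<beta>: "0 < \<beta>" "\<beta> < 1" and AC: "A + C \<le> 0"
    and v: "volterra \<beta> (\<lambda>s. A * X s + h (X s)) x0 X" and cont: "continuous_on {0..} X"
    and h: "\<And>x. 0 \<le> x \<Longrightarrow> x < d \<Longrightarrow> h x \<le> C * x" and x0: "\<bar>x0\<bar> < d" and t: "0 \<le> t"
  shows "X t \<le> \<bar>x0\<bar> * mittag_leffler \<beta> 1 ((A + C) * t powr \<beta>)"
proof -
  define l where "l = A + C"
  let ?E = "\<lambda>t. mittag_leffler \<beta> 1 (l * t powr \<beta>)"
  have l: "l \<le> 0" using AC by (simp add: l_def)
  have contE: "continuous_on {0..} ?E" by (rule continuous_mittag_leffler_powr[OF \<beta>])
  have Epos: "0 < ?E s" if "0 \<le> s" for s by (rule mittag_leffler_powr_pos[OF \<beta> l that])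
  have Ele: "?E s \<le> 1" for s by (rule mittag_leffler_le_1[OF \<beta>]) (use l in \<open>simp add: mult_nonpos_nonneg\<close>)
  have bound: "X t / ?E t \<le> c" if c: "\<bar>x0\<bar> < c" "c < d" for c
  proof -
    have c0: "0 < c" using c by linarith
    have "X t - c * ?E t < 0"
    proof (rule volterra_strict_comparison[OF \<beta> volterra_diff[OF v volterra_scale[OF volterra_mittag_leffler[OF \<beta>]]] _ _ _ _ t])
      show "continuous_on {0..} (\<lambda>t. X t - c * ?E t)" by (intro continuous_intros cont contE)
      show "x0 - c * 1 < 0" using c by simp
      show "0 \<le> - l" using l by simp
      fix T assume T: "0 < T" "X T - c * ?E T = 0" and neg: "\<And>s. s \<in> {0..<T} \<Longrightarrow> X s - c * ?E s < 0"
      \<comment> \<open>At the touching time X equals c E > 0, so X is positive shortly before,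
        where h(X) is at most C X. The forcing of X - c E is then at most l (X - c E). Halving
        \<open>r\<close> turns the strict distance condition into a closed one.\<close>
      have "0 < X T" using T c0 Epos[of T] by simp
      then obtain r where r: "0 < r" "\<And>s. s \<in> {0..} \<Longrightarrow> dist s T < r \<Longrightarrow> dist (X s) (X T) < X T"
        using cont T unfolding continuous_on_iff by (metis atLeast_iff less_imp_le)
      show "\<exists>a<T. \<forall>s. 0 \<le> s \<longrightarrow> a \<le> s \<longrightarrow> s \<le> T \<longrightarrow>
          A * X s + h (X s) - c * (l * ?E s) \<le> - l * - (X s - c * ?E s)"
      proof (intro exI[of _ "T - r / 2"] conjI allI impI)
        fix s assume s: "0 \<le> s" "T - r / 2 \<le> s" "s \<le> T"
        have "dist (X s) (X T) < X T" using r s by (auto simp: dist_real_def)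
        then have "0 < X s" by (auto simp: dist_real_def)
        have "X s \<le> c * ?E s" using neg[of s] T s by (cases "s = T") auto
        also have "\<dots> \<le> c * 1" using c0 Ele by (intro mult_left_mono) auto
        finally have "h (X s) \<le> C * X s" using \<open>0 < X s\<close> c by (intro h) auto
        then show "A * X s + h (X s) - c * (l * ?E s) \<le> - l * - (X s - c * ?E s)"
          by (simp add: l_def algebra_simps)
      qed (use r in auto)
    qed
    then show ?thesis using Epos[OF t] by (simp add: pos_divide_le_eq)
  qed
  have "X t / ?E t \<le> \<bar>x0\<bar>" by (rule dense_ge_bounded[OF x0]) (rule bound)
  then show ?thesis using Epos[OF t] by (simp add: pos_divide_le_eq l_def)
qed

lemma continuous_solution_mittag_leffler_bound:
  assumes \<beta>: "0 < \<beta>" "\<beta> < 1" and AC: "A + C \<le> 0" and X: "continuous_solution \<beta> A h x0 X"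
    and h: "\<And>x. \<bar>x\<bar> < d \<Longrightarrow> \<bar>h x\<bar> \<le> C * \<bar>x\<bar>" and x0: "\<bar>x0\<bar> < d" and t: "0 \<le> t"
  shows "\<bar>X t\<bar> \<le> \<bar>x0\<bar> * mittag_leffler \<beta> 1 ((A + C) * t powr \<beta>)"
proof -
  have v: "volterra \<beta> (\<lambda>s. A * X s + h (X s)) x0 X" and cont: "continuous_on {0..} X"
    using X by (auto simp: continuous_solution_def volterra_def)
  have "X t \<le> \<bar>x0\<bar> * mittag_leffler \<beta> 1 ((A + C) * t powr \<beta>)"
  proof (rule volterra_mittag_leffler_upper_bound[OF \<beta> AC v cont _ x0 t])
    show "h x \<le> C * x" if "0 \<le> x" "x < d" for x
      using h[of x] that by (auto simp: abs_le_iff)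
  qed
  \<comment> \<open>The negative of a solution solves the equation with nonlinearity -h(-x), which
    obeys the same bound.\<close>
  moreover have "- 1 * X t \<le> \<bar>- 1 * x0\<bar> * mittag_leffler \<beta> 1 ((A + C) * t powr \<beta>)"
  proof (rule volterra_mittag_leffler_upper_bound[OF \<beta> AC _ _ _ _ t, where X = "\<lambda>t. - 1 * X t" and h = "\<lambda>x. - h (- x)" and d = d])
    show "volterra \<beta> (\<lambda>s. A * (- 1 * X s) + - h (- (- 1 * X s))) (- 1 * x0) (\<lambda>t. - 1 * X t)"
      using volterra_scale[OF v, of "- 1"] by (simp add: algebra_simps)
    show "continuous_on {0..} (\<lambda>t. - 1 * X t)" by (intro continuous_intros cont)
    show "- h (- x) \<le> C * x" if "0 \<le> x" "x < d" for x
      using h[of "- x"] that by (auto simp: abs_le_iff)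
  qed (use x0 in auto)
  ultimately show ?thesis by (simp add: abs_le_iff)
qed

section \<open>Monotonicity and decay on the negative axis\<close>

text \<open>The solution E(z s^\<beta>) of the linear equation with A = z and h = 0 is bounded with
  C = w - z, which is admissible because C is nonnegative; then A + C = w. The radius
  \<open>d = 2\<close> merely has to exceed the initial value 1.\<close>

lemma mittag_leffler_mono:
  assumes \<beta>: "0 < \<beta>" "\<beta> < 1" and z: "z \<le> w" "w \<le> 0"
  shows "mittag_leffler \<beta> 1 z \<le> mittag_leffler \<beta> 1 w"
proof -
  have "mittag_leffler \<beta> 1 (z * 1 powr \<beta>) \<le> \<bar>1\<bar> * mittag_leffler \<beta> 1 ((z + (w - z)) * 1 powr \<beta>)"
    by (rule volterra_mittag_leffler_upper_bound[where h = "\<lambda>_. 0" and d = 2])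
       (use \<beta> z volterra_mittag_leffler[OF \<beta>, of z] continuous_mittag_leffler_powr[OF \<beta>, of z] in auto)
  then show ?thesis by simp
qed

text \<open>By monotonicity E(z s^\<beta>) is at least E(z) for s in [0, 1]. As z < 0, the integral
  equation at time 1 gives E(z) <= 1 + z E(z) / (\<beta> Gamma(\<beta>)), and positivity of E(z)
  bounds |z| E(z).\<close>

lemma mittag_leffler_decay:
  assumes \<beta>: "0 < \<beta>" "\<beta> < 1" and z: "z < 0"
  shows "mittag_leffler \<beta> 1 z \<le> Gamma \<beta> * \<beta> / \<bar>z\<bar>"
proof -
  let ?E = "\<lambda>s. mittag_leffler \<beta> 1 (z * s powr \<beta>)"
  have E: "set_integrable lborel {0..1} (\<lambda>s. (1 - s) powr (\<beta> - 1) * (z * ?E s))"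
    "?E 1 = 1 + 1 / Gamma \<beta> * (LINT s:{0..1}|lborel. (1 - s) powr (\<beta> - 1) * (z * ?E s))"
    using volterra_mittag_leffler[OF \<beta>, of z, unfolded volterra_def, THEN spec, of 1] by simp_all
  note K = powr_kernel_tail_integral[OF \<beta>(1), of 0 1]
  have "(LINT s:{0..1}|lborel. (1 - s) powr (\<beta> - 1) * (z * ?E s)) \<le> (LINT s:{0..1}|lborel. (z * ?E 1) * (1 - s) powr (\<beta> - 1))"
  proof (rule set_integral_mono[OF E(1) set_integrable_mult_right[OF K(1)]])
    fix s :: real assume s: "s \<in> {0..1}"
    have "s powr \<beta> \<le> 1" using s \<beta> by (simp add: powr_le1)
    then have "?E 1 \<le> ?E s"
      using z s by (intro mittag_leffler_mono[OF \<beta>]) (auto simp: mult_nonpos_nonneg)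
    then have "(1 - s) powr (\<beta> - 1) * (z * ?E s) \<le> (1 - s) powr (\<beta> - 1) * (z * ?E 1)"
      using z by (intro mult_left_mono mult_left_mono_neg) auto
    then show "(1 - s) powr (\<beta> - 1) * (z * ?E s) \<le> (z * ?E 1) * (1 - s) powr (\<beta> - 1)"
      by (simp add: mult_ac)
  qed simp
  also have "\<dots> = (z * ?E 1) / \<beta>" using K(2) by simp
  finally have "1 / Gamma \<beta> * (LINT s:{0..1}|lborel. (1 - s) powr (\<beta> - 1) * (z * ?E s)) \<le> 1 / Gamma \<beta> * ((z * ?E 1) / \<beta>)"
    using \<beta> by (intro mult_left_mono) auto
  then have "0 < 1 + 1 / Gamma \<beta> * ((z * ?E 1) / \<beta>)"
    using E(2) mittag_leffler_powr_pos[OF \<beta> less_imp_le[OF z], of 1] by linarith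
  then show ?thesis
    using \<beta> z Gamma_real_pos[OF \<beta>(1)] by (simp add: field_simps)
qed

lemma mittag_leffler_powr_tendsto_0:
  assumes \<beta>: "0 < \<beta>" "\<beta> < 1" and c: "c < 0"
  shows "((\<lambda>t. mittag_leffler \<beta> 1 (c * t powr \<beta>)) \<longlongrightarrow> 0) at_top"
proof (rule tendsto_sandwich)
  show "eventually (\<lambda>t. 0 \<le> mittag_leffler \<beta> 1 (c * t powr \<beta>)) at_top"
    using eventually_ge_at_top[of 0]
    by eventually_elim (use mittag_leffler_powr_pos[OF \<beta>, of c] c in \<open>simp add: less_imp_le\<close>)
  show "eventually (\<lambda>t. mittag_leffler \<beta> 1 (c * t powr \<beta>) \<le> Gamma \<beta> * \<beta> / \<bar>c\<bar> * t powr (- \<beta>)) at_top"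
    using eventually_gt_at_top[of 0]
  proof eventually_elim
    case (elim t)
    then have "c * t powr \<beta> < 0" using c by (simp add: mult_neg_pos)
    from mittag_leffler_decay[OF \<beta> this] show ?case
      by (simp add: abs_mult powr_minus divide_simps)
  qed
  show "((\<lambda>t. Gamma \<beta> * \<beta> / \<bar>c\<bar> * t powr (- \<beta>)) \<longlongrightarrow> 0) at_top"
    using \<beta> by (intro tendsto_mult_right_zero tendsto_neg_powr filterlim_ident) auto
qed auto

section \<open>From the Mittag-Leffler bound to the stability notions\<close>

lemma local_lipschitz_abs: "local_lipschitz T S (\<lambda>_. abs :: real \<Rightarrow> real)"
proof (rule local_lipschitzI)
  show "\<exists>u>0. \<exists>L. \<forall>t\<in>cball t u \<inter> T. L-lipschitz_on (cball x u \<inter> S) (abs :: real \<Rightarrow> real)" for t x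
    by (intro exI[of _ 1] conjI ballI lipschitz_onI) (auto simp: dist_real_def)
qed

lemma continuous_solution_tendsto_0:
  assumes \<beta>: "0 < \<beta>" "\<beta> < 1" and AC: "A + C < 0" and X: "continuous_solution \<beta> A h x0 X"
    and h: "\<And>x. \<bar>x\<bar> < d \<Longrightarrow> \<bar>h x\<bar> \<le> C * \<bar>x\<bar>" and x0: "\<bar>x0\<bar> < d"
  shows "(X \<longlongrightarrow> 0) at_top"
proof (rule Lim_null_comparison)
  show "eventually (\<lambda>t. norm (X t) \<le> \<bar>x0\<bar> * mittag_leffler \<beta> 1 ((A + C) * t powr \<beta>)) at_top"
    using eventually_ge_at_top[of 0]
  proof eventually_elim
    case (elim t)
    then show ?case
      using continuous_solution_mittag_leffler_bound[OF \<beta> less_imp_le[OF AC] X h x0] by simp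
  qed
  show "((\<lambda>t. \<bar>x0\<bar> * mittag_leffler \<beta> 1 ((A + C) * t powr \<beta>)) \<longlongrightarrow> 0) at_top"
    by (intro tendsto_mult_right_zero mittag_leffler_powr_tendsto_0 \<beta> AC)
qed

lemma mittag_leffler_stable_if_linear_bound:
  assumes \<beta>: "0 < \<beta>" "\<beta> < 1" and AC: "A + C < 0" and d: "0 < d"
    and h: "\<And>x. \<bar>x\<bar> < d \<Longrightarrow> \<bar>h x\<bar> \<le> C * \<bar>x\<bar>"
  shows "mittag_leffler_stable \<beta> A h"
  unfolding mittag_leffler_stable_def
\<comment> \<open>The bound shown below fixes the witnesses by unification: \<delta> = d, B = A + C,
  b = 1 and m = \<open>abs\<close>.\<close>
proof (intro exI conjI allI impI)
  fix x0 X and t :: real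
  assume X: "\<bar>x0\<bar> < d" "continuous_solution \<beta> A h x0 X" and t: "0 \<le> t"
  have "\<bar>X t\<bar> \<le> \<bar>x0\<bar> * mittag_leffler \<beta> 1 ((A + C) * t powr \<beta>)"
    by (rule continuous_solution_mittag_leffler_bound[OF \<beta> less_imp_le[OF AC] X(2) h X(1) t])
  \<comment> \<open>Removing the exponent 1 from \<open>powr\<close> uses that the base is
    nonnegative, hence the positivity of E.\<close>
  also have "\<dots> = (\<bar>x0\<bar> * mittag_leffler \<beta> 1 ((A + C) * t powr \<beta>)) powr 1"
    using mittag_leffler_powr_pos[OF \<beta> less_imp_le[OF AC] t] by simp
  finally show "\<bar>X t\<bar> \<le> (\<bar>x0\<bar> * mittag_leffler \<beta> 1 ((A + C) * t powr \<beta>)) powr 1" .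
qed (use d AC local_lipschitz_abs in auto)

lemma asymptotically_stable_if_linear_bound:
  assumes \<beta>: "0 < \<beta>" "\<beta> < 1" and AC: "A + C < 0" and d: "0 < d"
    and h: "\<And>x. \<bar>x\<bar> < d \<Longrightarrow> \<bar>h x\<bar> \<le> C * \<bar>x\<bar>"
  shows "asymptotically_stable \<beta> A h"
  unfolding asymptotically_stable_def
proof
  show "stable \<beta> A h"
    unfolding stable_def
  proof (intro allI impI)
    fix \<epsilon> :: real assume \<epsilon>: "0 < \<epsilon>"
    show "\<exists>\<delta>>0. \<forall>x0 X. \<bar>x0\<bar> < \<delta> \<longrightarrow> continuous_solution \<beta> A h x0 X \<longrightarrow> (\<forall>t\<ge>0. \<bar>X t\<bar> < \<epsilon>)"
    \<comment> \<open>The radius \<open>d\<close> gives the Mittag-Leffler bound; since E is at most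
      1, |X t| never exceeds |x0|, so \<open>\<epsilon>\<close> itself serves as the other
      radius.\<close>
    proof (intro exI[of _ "min \<epsilon> d"] conjI allI impI)
      fix x0 X and t :: real
      assume x0: "\<bar>x0\<bar> < min \<epsilon> d" and X: "continuous_solution \<beta> A h x0 X" and t: "0 \<le> t"
      have "\<bar>X t\<bar> \<le> \<bar>x0\<bar> * mittag_leffler \<beta> 1 ((A + C) * t powr \<beta>)"
        using x0 by (intro continuous_solution_mittag_leffler_bound[OF \<beta> less_imp_le[OF AC] X h _ t]) auto
      also have "\<dots> \<le> \<bar>x0\<bar> * 1"
        using AC by (intro mult_left_mono mittag_leffler_le_1[OF \<beta>]) (auto simp: mult_nonpos_nonneg)
      finally show "\<bar>X t\<bar> < \<epsilon>" using x0 by simp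
    qed (use \<epsilon> d in auto)
  qed
  show "stable_in_the_large \<beta> A h"
    unfolding stable_in_the_large_def
    using d continuous_solution_tendsto_0[OF \<beta> AC _ h] by blast
qed

theorem proposition3p5:
  fixes \<beta> A :: real and h :: "real \<Rightarrow> real"
  assumes "0 < \<beta>" and "\<beta> < 1" and "A < 0"
    and "h \<in> borel_measurable borel"
  shows "((\<exists>\<delta>\<^sub>0>0. \<exists>C>0. A + C < 0 \<and> (\<forall>x. \<bar>x\<bar> < \<delta>\<^sub>0 \<longrightarrow> \<bar>h x\<bar> \<le> C * \<bar>x\<bar>)) \<longrightarrow>
            mittag_leffler_stable \<beta> A h \<and> asymptotically_stable \<beta> A h) \<and>
         ((\<exists>C>0. A + C < 0 \<and> (\<forall>x. \<bar>h x\<bar> \<le> C * \<bar>x\<bar>)) \<longrightarrow>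
            mittag_leffler_stable \<beta> A h \<and> globally_stable_in_the_large \<beta> A h)"
proof (intro conjI impI; elim exE conjE)
  fix \<delta>\<^sub>0 C
  assume *: "0 < \<delta>\<^sub>0" "A + C < 0" and h: "\<forall>x. \<bar>x\<bar> < \<delta>\<^sub>0 \<longrightarrow> \<bar>h x\<bar> \<le> C * \<bar>x\<bar>"
  show "mittag_leffler_stable \<beta> A h"
    by (rule mittag_leffler_stable_if_linear_bound[OF assms(1,2) *(2,1)]) (use h in blast)
  show "asymptotically_stable \<beta> A h"
    by (rule asymptotically_stable_if_linear_bound[OF assms(1,2) *(2,1)]) (use h in blast)
next
  fix C
  assume AC: "A + C < 0" and h: "\<forall>x. \<bar>h x\<bar> \<le> C * \<bar>x\<bar>"
  show "mittag_leffler_stable \<beta> A h"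
    \<comment> \<open>The bound on \<open>h\<close> is global, so the radius can be chosen freely: 1
      here, and a number above |x0|, depending on the solution, for the limit.\<close>
    by (rule mittag_leffler_stable_if_linear_bound[OF assms(1,2) AC zero_less_one]) (use h in blast)
  show "globally_stable_in_the_large \<beta> A h"
    unfolding globally_stable_in_the_large_def
  proof (intro allI impI)
    fix x0 X assume X: "continuous_solution \<beta> A h x0 X"
    show "(X \<longlongrightarrow> 0) at_top"
      by (rule continuous_solution_tendsto_0[OF assms(1,2) AC X, of "\<bar>x0\<bar> + 1"]) (use h in auto)
  qed
qed

end
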